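(* Let $n\in\mathbb{N}$ and let $p\in\mathcal{P}(\mathbb{R}^n)$. Then $L_{p(\cdot),p(\cdot)}(\mathbb{R}^n)=L_{p(\cdot)}(\mathbb{R}^n)$, where $L_{p(\cdot),p(\cdot)}(\mathbb{R}^n)$ is the variable exponent Lorentz space $L_{p(\cdot),q(\cdot)}(\mathbb{R}^n)$ with $q(\cdot)=p(\cdot)$ and $L_{p(\cdot)}(\mathbb{R}^n)$ is the variable exponent Lebesgue space.
   Context: Equality of two quasi-normed function spaces means that they consist of the same functions (identified almost everywhere) and that their quasi-norms are equivalent, i.e. each is bounded by a constant (independent of the function) times the other. $\mathcal{P}(\mathbb{R}^n)$ is the class of all measurable functions $p:\mathbb{R}^n\to(0,\infty]$ with $p^-:=\operatorname{ess\,inf}_{x\in\mathbb{R}^n}p(x)>0$; the value $\infty$ is allowed, and $p^+:=\operatorname{ess\,sup}_{x}p(x)\in(0,\infty]$. For $t\ge 0$ put $\varphi_p(t)=t^p$ if $p\in(0,\infty)$; $\varphi_\infty(t)=0$ if $t\le1$ and $\varphi_\infty(t)=\infty$ if $t>1$. For $p\in\mathcal{P}(\mathbb{R}^n)$ and measurable $f$ let $\varrho_{p(\cdot)}(f)=\int_{\mathbb{R}^n}\varphi_{p(x)}(|f(x)|)\,dx$. The variable exponent Lebesgue space $L_{p(\cdot)}(\mathbb{R}^n)$ consists of all measurable $f:\mathbb{R}^n\to\mathbb{C}$ such that $\varrho_{p(\cdot)}(f/\lambda)<\infty$ for some $\lambda>0$, with quasi-norm $\|f|L_{p(\cdot)}(\mathbb{R}^n)\|=\inf\{\lambda>0:\varrho_{p(\cdot)}(f/\lambda)\le1\}$.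 For a sequence $(f_k)_{k\in\mathbb{Z}}$ of measurable functions and $p,q\in\mathcal{P}(\mathbb{R}^n)$ let $$\varrho_{\ell_{q(\cdot)}(L_{p(\cdot)})}\big((f_k)_k\big)=\sum_{k\in\mathbb{Z}}\inf\Big\{\lambda_k>0:\varrho_{p(\cdot)}\Big(\frac{f_k}{\lambda_k^{1/q(\cdot)}}\Big)\le1\Big\},$$ with the conventions $\lambda^{1/\infty}=1$ and $\inf\emptyset=\infty$. $L_{p(\cdot),q(\cdot)}(\mathbb{R}^n)$ is the collection of all measurable $f:\mathbb{R}^n\to\mathbb{C}$ with $$\|f|L_{p(\cdot),q(\cdot)}(\mathbb{R}^n)\|=\inf\Big\{\lambda>0:\varrho_{\ell_{q(\cdot)}(L_{p(\cdot)})}\Big(\big(2^k\chi_{\{x\in\mathbb{R}^n:|f(x)/\lambda|>2^k\}}\big)_{k\in\mathbb{Z}}\Big)\le1\Big\}<\infty,$$ where $\chi_A$ is the characteristic function of $A$. *)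

theory Defs
  imports "HOL-Analysis.Analysis"
begin

text \<open>Exponents take values in \<^typ>\<open>ennreal\<close>, so that the value \<open>\<infinity>\<close> is allowed. "Measurable" means
  Lebesgue measurable. Function spaces are sets of functions rather than of almost-everywhere
  classes; they are closed under almost-everywhere equality, and the quasi-norms respect it
  (see the lemmas at the end).\<close>

definition essinf :: "'a measure \<Rightarrow> ('a \<Rightarrow> ennreal) \<Rightarrow> ennreal" where
  "essinf M p = Sup {c. AE x in M. c \<le> p x}"

definition var_exponents :: "(real ^ 'n \<Rightarrow> ennreal) set" where
  "var_exponents =
     {p. p \<in> borel_measurable lebesgue \<and> (\<forall>x. 0 < p x) \<and> 0 < essinf lebesgue p}"

definition phi :: "ennreal \<Rightarrow> real \<Rightarrow> ennreal" where
  "phi p t = (if p = \<infinity> then (if t \<le> 1 then 0 else \<infinity>) else ennreal (t powr enn2real p))"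

definition modular :: "(real ^ 'n \<Rightarrow> ennreal) \<Rightarrow> (real ^ 'n \<Rightarrow> complex) \<Rightarrow> ennreal" where
  "modular p f = (\<integral>\<^sup>+x. phi (p x) (norm (f x)) \<partial>lebesgue)"

definition var_Lebesgue :: "(real ^ 'n \<Rightarrow> ennreal) \<Rightarrow> (real ^ 'n \<Rightarrow> complex) set" where
  "var_Lebesgue p =
     {f \<in> borel_measurable lebesgue. \<exists>l>0. modular p (\<lambda>x. f x / complex_of_real l) < \<infinity>}"

definition var_Lebesgue_norm :: "(real ^ 'n \<Rightarrow> ennreal) \<Rightarrow> (real ^ 'n \<Rightarrow> complex) \<Rightarrow> ennreal" where
  "var_Lebesgue_norm p f =
     Inf {ennreal l | l. 0 < l \<and> modular p (\<lambda>x. f x / complex_of_real l) \<le> 1}"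

text \<open>The power \<open>l\<^bsup>1/q\<^esup>\<close> for \<open>l > 0\<close>, with \<open>l\<^bsup>1/\<infinity>\<^esup> = 1\<close>.\<close>

definition root_exp :: "real \<Rightarrow> ennreal \<Rightarrow> real" where
  "root_exp l q = (if q = \<infinity> then 1 else l powr (1 / enn2real q))"

definition mixed_modular ::
    "(real ^ 'n \<Rightarrow> ennreal) \<Rightarrow> (real ^ 'n \<Rightarrow> ennreal) \<Rightarrow> (int \<Rightarrow> real ^ 'n \<Rightarrow> complex) \<Rightarrow> ennreal" where
  "mixed_modular q p f =
     (\<Sum>\<^sub>\<infinity>k\<in>UNIV. Inf {ennreal l | l. 0 < l \<and>
        modular p (\<lambda>x. f k x / complex_of_real (root_exp l (q x))) \<le> 1})"

definition level_seq :: "(real ^ 'n \<Rightarrow> complex) \<Rightarrow> int \<Rightarrow> real ^ 'n \<Rightarrow> complex" where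
  "level_seq f k = (\<lambda>x. 2 powi k * indicator {x. norm (f x) > 2 powi k} x)"

definition var_Lorentz_norm ::
    "(real ^ 'n \<Rightarrow> ennreal) \<Rightarrow> (real ^ 'n \<Rightarrow> ennreal) \<Rightarrow> (real ^ 'n \<Rightarrow> complex) \<Rightarrow> ennreal" where
  "var_Lorentz_norm p q f =
     Inf {ennreal l | l. 0 < l \<and>
        mixed_modular q p (level_seq (\<lambda>x. f x / complex_of_real l)) \<le> 1}"

definition var_Lorentz ::
    "(real ^ 'n \<Rightarrow> ennreal) \<Rightarrow> (real ^ 'n \<Rightarrow> ennreal) \<Rightarrow> (real ^ 'n \<Rightarrow> complex) set" where
  "var_Lorentz p q = {f \<in> borel_measurable lebesgue. var_Lorentz_norm p q f < \<infinity>}"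

definition equal_quasi_normed ::
    "'f set \<Rightarrow> ('f \<Rightarrow> ennreal) \<Rightarrow> 'f set \<Rightarrow> ('f \<Rightarrow> ennreal) \<Rightarrow> bool" where
  "equal_quasi_normed X NX Y NY \<longleftrightarrow> X = Y \<and>
     (\<exists>C::real. 0 < C \<and> (\<forall>f\<in>X. NX f \<le> ennreal C * NY f)) \<and>
     (\<exists>C::real. 0 < C \<and> (\<forall>f\<in>X. NY f \<le> ennreal C * NX f))"

lemma modular_cong_AE:
  assumes "AE x in lebesgue. f x = g x"
  shows "modular p f = modular p g"
  unfolding modular_def by (rule nn_integral_cong_AE) (use assms in auto)

lemma var_Lebesgue_norm_cong_AE:
  assumes "AE x in lebesgue. f x = g x"
  shows "var_Lebesgue_norm p f = var_Lebesgue_norm p g"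
proof -
  have "modular p (\<lambda>x. f x / complex_of_real l) = modular p (\<lambda>x. g x / complex_of_real l)" for l
    by (rule modular_cong_AE) (use assms in auto)
  then show ?thesis by (simp add: var_Lebesgue_norm_def)
qed

lemma var_Lorentz_norm_cong_AE:
  assumes "AE x in lebesgue. f x = g x"
  shows "var_Lorentz_norm p q f = var_Lorentz_norm p q g"
proof -
  have "modular p (\<lambda>x. level_seq (\<lambda>x. f x / complex_of_real l) k x / complex_of_real (root_exp m (q x)))
      = modular p (\<lambda>x. level_seq (\<lambda>x. g x / complex_of_real l) k x / complex_of_real (root_exp m (q x)))"
    for l k m
    by (rule modular_cong_AE) (use assms in \<open>auto simp: level_seq_def indicator_def\<close>)
  then show ?thesis by (simp add: var_Lorentz_norm_def mixed_modular_def)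
qed

lemma var_Lebesgue_cong_AE:
  assumes "AE x in lebesgue. f x = g x" and "f \<in> var_Lebesgue p"
  shows "g \<in> var_Lebesgue p"
proof -
  have "g \<in> borel_measurable lebesgue"
    using borel_measurable_AE[of f g] assms by (auto simp: var_Lebesgue_def)
  moreover have "modular p (\<lambda>x. f x / complex_of_real l) = modular p (\<lambda>x. g x / complex_of_real l)" for l
    by (rule modular_cong_AE) (use assms in auto)
  ultimately show ?thesis using assms(2) by (simp add: var_Lebesgue_def)
qed

lemma var_Lorentz_cong_AE:
  assumes "AE x in lebesgue. f x = g x" and "f \<in> var_Lorentz p q"
  shows "g \<in> var_Lorentz p q"
proof -
  have "g \<in> borel_measurable lebesgue"
    using borel_measurable_AE[of f g] assms by (auto simp: var_Lorentz_def)
  then show ?thesis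
    using assms(2) var_Lorentz_norm_cong_AE[OF assms(1)] by (simp add: var_Lorentz_def)
qed

end

theory Submission
  imports Defs
begin

text \<open>When both exponents are \<open>p\<close>, the Lorentz modular is a discretised Lebesgue modular. The reason
  is that dividing by \<open>\<lambda>\<^bsup>1/p(x)\<^esup>\<close> inside \<open>\<phi>\<^bsub>p(x)\<^esub>\<close> amounts to dividing by \<open>\<lambda>\<close> outside
  (\<open>phi_div_root_exp\<close>), at points with \<open>p(x) = \<infinity>\<close> as well, since there \<open>\<phi>\<close> takes only the values \<open>0\<close>
  and \<open>\<infinity>\<close>. So the infimum over \<open>\<lambda>\<^sub>k\<close> is exactly the modular of the \<open>k\<close>-th level function, and Tonelli
  turns the sum over \<open>k\<close> into \<open>\<integral> S\<^bsub>p(x)\<^esub>(|f(x)|) dx\<close> with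
  \<open>S\<^sub>r(t) = \<Sum>\<^bsub>2\<^sup>k < t\<^esub> \<phi>\<^sub>r(2\<^sup>k)\<close> (\<open>mixed_modular_level_seq\<close>).

  For finite \<open>r\<close> the sum \<open>S\<^sub>r(t)\<close> is a geometric series, dominated by its largest term, and the
  largest \<open>2\<^sup>k < t\<close> is at least \<open>t/2\<close>. If \<open>r \<ge> a > 0\<close>, this gives
  \<open>\<phi>\<^sub>r(t/2) \<le> S\<^sub>r(t) \<le> (1 - 2\<^bsup>-a\<^esup>)\<^sup>-\<^sup>1 \<phi>\<^sub>r(t)\<close>, also for \<open>r = \<infinity>\<close>
  (\<open>phi_half_le_dyadic_sum\<close>, \<open>dyadic_sum_le_phi\<close>). Since the essential infimum of \<open>p\<close> is positive, such
  an \<open>a\<close> exists with \<open>p \<ge> a\<close> almost everywhere, and the two modulars are comparable after a dilation.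

  The left inequality compares the quasi-norms with constant \<open>2\<close>. For the other direction the factor
  \<open>K = (1 - 2\<^bsup>-a\<^esup>)\<^sup>-\<^sup>1\<close> has to be absorbed: dividing the function by \<open>c \<ge> 1\<close> shrinks the modular by
  \<open>c\<^bsup>-a\<^esup>\<close> (\<open>modular_scale_down\<close>), so \<open>c = K\<^bsup>1/a\<^esup>\<close> does it. A dilation also shows that the Lebesgue
  space consists precisely of the functions with finite quasi-norm, hence the two spaces
  coincide.\<close>

section \<open>Quotients and sums of extended nonnegative reals\<close>

lemma ennreal_divide_le_iff:
  assumes "0 < c"
  shows "x / ennreal c \<le> y \<longleftrightarrow> x \<le> y * ennreal c"
proof
  assume "x / ennreal c \<le> y"
  then have "x / ennreal c * ennreal c \<le> y * ennreal c"
    by (rule mult_right_mono) simp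
  then show "x \<le> y * ennreal c"
    using assms by (simp add: ennreal_divide_times)
next
  assume "x \<le> y * ennreal c"
  then show "x / ennreal c \<le> y"
    using assms by (intro divide_le_posI_ennreal) (simp_all add: mult.commute)
qed

text \<open>Writing the sum over \<open>k\<close> as an integral lets Tonelli interchange it with the integral over
  \<open>x\<close>.\<close>
lemma infsum_ennreal_eq_nn_integral:
  fixes f :: "int \<Rightarrow> ennreal"
  shows "(\<Sum>\<^sub>\<infinity>k\<in>UNIV. f k) = (\<integral>\<^sup>+k. f k \<partial>count_space UNIV)"
proof (rule antisym)
  have "sum f F \<le> (\<integral>\<^sup>+k. f k \<partial>count_space UNIV)" if "finite F" for F
  proof -
    have "sum f F = (\<integral>\<^sup>+k. f k * indicator F k \<partial>count_space UNIV)"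
      using that by (subst nn_integral_count_space_indicator[symmetric])
        (simp_all add: nn_integral_count_space_finite NO_MATCH_def)
    also have "\<dots> \<le> (\<integral>\<^sup>+k. f k \<partial>count_space UNIV)"
      by (intro nn_integral_mono) (auto simp: indicator_def)
    finally show ?thesis .
  qed
  then show "(\<Sum>\<^sub>\<infinity>k\<in>UNIV. f k) \<le> (\<integral>\<^sup>+k. f k \<partial>count_space UNIV)"
    by (subst nonneg_infsum_complete) (auto intro!: SUP_least)
next
  have "(\<integral>\<^sup>+k. f k \<partial>count_space UNIV) = (\<Sum>i. f (int_decode i))"
    using nn_integral_bij_count_space[OF bij_int_decode, of f]
    by (simp add: nn_integral_count_space_nat)
  also have "\<dots> = (SUP N. \<Sum>i<N. f (int_decode i))"
    by (simp add: suminf_eq_SUP)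
  also have "\<dots> \<le> (\<Sum>\<^sub>\<infinity>k\<in>UNIV. f k)"
  proof (rule SUP_least)
    fix N :: nat
    have "(\<Sum>i<N. f (int_decode i)) = sum f (int_decode ` {..<N})"
      by (subst sum.reindex) (auto intro: inj_on_subset[OF inj_int_decode])
    also have "\<dots> \<le> (\<Sum>\<^sub>\<infinity>k\<in>UNIV. f k)"
      by (subst nonneg_infsum_complete) (auto intro!: SUP_upper)
    finally show "(\<Sum>i<N. f (int_decode i)) \<le> (\<Sum>\<^sub>\<infinity>k\<in>UNIV. f k)" .
  qed
  finally show "(\<integral>\<^sup>+k. f k \<partial>count_space UNIV) \<le> (\<Sum>\<^sub>\<infinity>k\<in>UNIV. f k)" .
qed

section \<open>The pointwise scaling of the integrand\<close>

lemma phi_zero [simp]: "phi r 0 = 0"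
  by (simp add: phi_def)

lemma measurable_phi [measurable]:
  assumes [measurable]: "p \<in> borel_measurable M" "u \<in> borel_measurable M"
  shows "(\<lambda>x. phi (p x) (u x)) \<in> borel_measurable M"
  unfolding phi_def by measurable

text \<open>For finite \<open>r\<close> the exponents \<open>1/r\<close> and \<open>r\<close> cancel. For \<open>r = \<infinity>\<close> the left-hand side is \<open>phi r t\<close>,
  whose values \<open>0\<close> and \<open>\<infinity>\<close> are unchanged by the division on the right.\<close>
lemma phi_div_root_exp:
  assumes "0 < l" "0 < r" "0 \<le> t"
  shows "phi r (t / root_exp l r) = phi r t / ennreal l"
proof (cases "r = \<infinity>")
  case True
  then show ?thesis
    using assms by (simp add: phi_def root_exp_def ennreal_top_divide)
next
  case False
  define s where "s = enn2real r"
  have s: "0 < s"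
    using False assms by (simp add: s_def enn2real_positive_iff top.not_eq_extremum)
  have "(t / l powr (1 / s)) powr s = t powr s / l"
    using assms s by (simp add: powr_divide powr_powr)
  then show ?thesis
    using False assms by (simp add: phi_def root_exp_def divide_ennreal flip: s_def)
qed

text \<open>As \<open>c \<ge> 1\<close>, the exact factor \<open>c\<^bsup>-r\<^esup>\<close> is largest at the smallest admissible exponent, so one
  factor serves all exponents \<open>r \<ge> a\<close>. For \<open>r = \<infinity>\<close> the right-hand side is \<open>\<infinity>\<close> if \<open>t > 1\<close>, and
  both sides vanish if \<open>t \<le> 1\<close>.\<close>
lemma phi_scale_down:
  assumes "0 < a" "ennreal a \<le> r" "1 \<le> c" "0 \<le> t"
  shows "phi r (t / c) \<le> ennreal (c powr - a) * phi r t"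
proof (cases "r = \<infinity>")
  case True
  have "t / c \<le> 1" if "t \<le> 1"
    using assms that by (simp add: divide_le_eq)
  then show ?thesis
    using True assms by (auto simp: phi_def ennreal_mult_top)
next
  case False
  define s where "s = enn2real r"
  have s: "a \<le> s"
    using False assms(1) enn2real_mono[OF assms(2)] by (simp add: s_def top.not_eq_extremum)
  have "(t / c) powr s = c powr - s * t powr s"
    using assms by (simp add: powr_divide powr_minus field_simps)
  also have "\<dots> \<le> c powr - a * t powr s"
    using assms s by (intro mult_right_mono powr_mono) auto
  finally show ?thesis
    using False by (simp add: phi_def ennreal_leI flip: ennreal_mult s_def)
qed

section \<open>Dyadic layers\<close>

definition layer :: "real \<Rightarrow> int \<Rightarrow> real" where
  "layer t k = (if 2 powi k < t then 2 powi k else 0)"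

lemma measurable_layer [measurable]:
  assumes [measurable]: "u \<in> borel_measurable M"
  shows "(\<lambda>x. layer (u x) k) \<in> borel_measurable M"
  unfolding layer_def by measurable

lemma norm_level_seq: "norm (level_seq f k x) = layer (norm (f x)) k"
  by (simp add: level_seq_def layer_def norm_mult norm_power_int)

text \<open>This is \<open>S\<^sub>r(t) = \<Sum>\<^bsub>2\<^sup>k < t\<^esub> \<phi>\<^sub>r(2\<^sup>k)\<close>: the layers with \<open>2\<^sup>k \<ge> t\<close> vanish and
  contribute \<open>\<phi>\<^sub>r(0) = 0\<close>.\<close>
definition dyadic_sum :: "ennreal \<Rightarrow> real \<Rightarrow> ennreal" where
  "dyadic_sum r t = (\<integral>\<^sup>+k. phi r (layer t k) \<partial>count_space UNIV)"

lemma dyadic_bracket: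
  fixes t :: real
  assumes "0 < t"
  obtains m :: int where "2 powi m < t" "t \<le> 2 powi (m + 1)"
proof
  define m where "m = \<lceil>log 2 t\<rceil> - 1"
  have "real_of_int m < log 2 t" "log 2 t \<le> real_of_int (m + 1)"
    unfolding m_def by linarith+
  then show "2 powi m < t" "t \<le> 2 powi (m + 1)"
    using assms by (simp_all add: less_log_iff log_le_iff flip: powr_real_of_int')
qed

text \<open>The single term of the largest \<open>2\<^sup>k < t\<close> suffices, because \<open>t/2 \<le> 2\<^sup>k\<close> and \<open>phi r\<close> is
  monotone.\<close>
lemma phi_half_le_dyadic_sum:
  assumes "0 \<le> t"
  shows "phi r (t / 2) \<le> dyadic_sum r t"
proof (cases "t = 0")
  case False
  with assms obtain m where m: "2 powi m < t" "t \<le> 2 powi (m + 1)"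
    using dyadic_bracket[of t] by auto
  have half: "t / 2 \<le> 2 powi m"
    using m by (simp add: power_int_add)
  have "phi r (t / 2) \<le> phi r (layer t m)"
    using m half assms by (auto simp: phi_def layer_def intro!: ennreal_leI powr_mono2)
  also have "\<dots> \<le> dyadic_sum r t"
    unfolding dyadic_sum_def by (rule nn_integral_ge_point) simp
  finally show ?thesis .
qed simp

text \<open>If \<open>r\<close> is finite and \<open>2\<^sup>m\<close> is the largest power below \<open>t\<close>, the sum is the geometric series
  \<open>2\<^bsup>mr\<^esup> \<Sum>\<^sub>j 2\<^bsup>-jr\<^esup>\<close>, whose ratio is at most \<open>2\<^bsup>-a\<^esup> < 1\<close>. If \<open>r = \<infinity>\<close>, then either \<open>t \<le> 1\<close> and all
  terms vanish, or the right-hand side is infinite.\<close>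
lemma dyadic_sum_le_phi:
  assumes "0 < a" "ennreal a \<le> r" "0 \<le> t"
  shows "dyadic_sum r t \<le> ennreal (1 / (1 - 2 powr - a)) * phi r t"
proof (cases "r = \<infinity>")
  case True
  have pos: "0 < 1 / (1 - 2 powr - a)"
    using assms by (simp add: powr_less_one)
  show ?thesis
  proof (cases "t \<le> 1")
    case True
    then have "phi r (layer t k) = 0" for k
      using \<open>r = \<infinity>\<close> by (auto simp: phi_def layer_def)
    then show ?thesis by (simp add: dyadic_sum_def)
  next
    case False
    then show ?thesis
      using \<open>r = \<infinity>\<close> pos assms(1) by (simp add: phi_def ennreal_mult_top)
  qed
next
  case False
  define s where "s = enn2real r"
  have s: "a \<le> s"
    using False assms(1) enn2real_mono[OF assms(2)] by (simp add: s_def top.not_eq_extremum)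
  show ?thesis
  proof (cases "t = 0")
    case True
    then have "layer t k = 0" for k
      by (simp add: layer_def not_less)
    then show ?thesis by (simp add: dyadic_sum_def)
  next
    case False
    with assms obtain m where m: "2 powi m < t" "t \<le> 2 powi (m + 1)"
      using dyadic_bracket[of t] by auto
    have active: "2 powi k < t \<longleftrightarrow> k \<le> m" for k :: int
    proof
      assume "2 powi k < t"
      then have "\<not> (2::real) powi (m + 1) \<le> 2 powi k" using m by linarith
      then have "\<not> m + 1 \<le> k" using power_int_increasing[of "m + 1" k "2::real"] by auto
      then show "k \<le> m" by simp
    next
      assume "k \<le> m"
      then have "(2::real) powi k \<le> 2 powi m" by (simp add: power_int_increasing)
      then show "2 powi k < t" using m by linarith
    qed
    define q where "q = (2::real) powr - s"
    have q: "0 < q" "q < 1" "q \<le> 2 powr - a"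
      using s assms by (auto simp: q_def powr_less_one)
    have a1: "2 powr - a < (1::real)" using assms by (simp add: powr_less_one)
    \<comment> \<open>Counting down from the top layer turns the sum over all \<open>k \<le> m\<close> into a power series in \<open>q\<close>.\<close>
    have bij: "bij_betw (\<lambda>j. m - int j) UNIV {..m}"
      by (rule bij_betwI[where g = "\<lambda>k. nat (m - k)"]) auto
    have "dyadic_sum r t = (\<integral>\<^sup>+k. phi r (layer t k) \<partial>count_space {..m})"
      unfolding dyadic_sum_def
      by (rule nn_integral_count_space_eq) (auto simp: layer_def active)
    also have "\<dots> = (\<Sum>j. phi r (layer t (m - int j)))"
      by (simp add: nn_integral_bij_count_space[OF bij, symmetric] nn_integral_count_space_nat)
    also have "\<dots> = (\<Sum>j. ennreal ((2 powi m) powr s * q ^ j))"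
    proof (rule arg_cong[where f = suminf], rule ext)
      fix j
      have "(2 powi (m - int j)) powr s = (2 powi m) powr s * q ^ j"
        by (simp add: q_def powr_powr powr_add[symmetric] algebra_simps
            flip: powr_real_of_int' powr_realpow)
      then show "phi r (layer t (m - int j)) = ennreal ((2 powi m) powr s * q ^ j)"
        using \<open>r \<noteq> \<infinity>\<close> by (simp add: phi_def layer_def active flip: s_def)
    qed
    also have "\<dots> = ennreal ((2 powi m) powr s * (1 / (1 - q)))"
      using q by (intro suminf_ennreal_eq sums_mult geometric_sums) auto
    also have "\<dots> \<le> ennreal (t powr s * (1 / (1 - 2 powr - a)))"
      using q a1 m s assms
      by (intro ennreal_leI mult_mono powr_mono2 divide_left_mono mult_pos_pos) auto
    also have "\<dots> = ennreal (1 / (1 - 2 powr - a)) * phi r t"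
      using \<open>r \<noteq> \<infinity>\<close> a1 by (simp add: phi_def mult.commute flip: ennreal_mult s_def)
    finally show ?thesis .
  qed
qed

section \<open>The Lorentz modular as a single integral\<close>

lemma measurable_level_seq:
  assumes [measurable]: "f \<in> borel_measurable lebesgue"
  shows "(\<lambda>x. norm (level_seq f k x)) \<in> borel_measurable lebesgue"
  unfolding norm_level_seq by measurable

text \<open>The case \<open>I = \<infinity>\<close> relies on \<open>inf \<emptyset> = \<infinity>\<close>. The case \<open>I = 0\<close>, where the infimum is not
  attained, is why the proof approximates by \<open>I + \<epsilon>\<close>.\<close>
lemma Inf_ennreal_positive_upper_bounds:
  "Inf {ennreal l | l. 0 < l \<and> I \<le> ennreal l} = I"
proof (rule antisym)
  show "I \<le> Inf {ennreal l | l. 0 < l \<and> I \<le> ennreal l}"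
    by (auto intro: Inf_greatest)
  show "Inf {ennreal l | l. 0 < l \<and> I \<le> ennreal l} \<le> I"
  proof (rule ennreal_le_epsilon)
    fix e :: real
    assume "I < top" "0 < e"
    then have "ennreal (enn2real I + e) = I + ennreal e"
      by simp
    with \<open>0 < e\<close> show "Inf {ennreal l | l. 0 < l \<and> I \<le> ennreal l} \<le> I + ennreal e"
      by (intro Inf_lower CollectI exI[of _ "enn2real I + e"]) (auto simp: add_nonneg_pos)
  qed
qed

text \<open>Because the scale parameter factors out of the modular when the two exponents agree, the
  condition on \<open>\<lambda>\<^sub>k\<close> reads \<open>\<rho>(g\<^sub>k) \<le> \<lambda>\<^sub>k\<close>, and the infimum over \<open>\<lambda>\<^sub>k\<close> can be evaluated.\<close>
lemma mixed_modular_diagonal: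
  assumes [measurable]: "p \<in> borel_measurable lebesgue"
    and pos: "\<And>x. 0 < p x"
    and meas: "\<And>k. (\<lambda>x. norm (g k x)) \<in> borel_measurable lebesgue"
  shows "mixed_modular p p g = (\<Sum>\<^sub>\<infinity>k\<in>UNIV. modular p (g k))"
proof -
  have scale: "modular p (\<lambda>x. g k x / complex_of_real (root_exp l (p x))) \<le> 1
      \<longleftrightarrow> modular p (g k) \<le> ennreal l" if "0 < l" for k l
  proof -
    have "0 \<le> root_exp l (p x)" for x
      by (simp add: root_exp_def)
    then have "modular p (\<lambda>x. g k x / complex_of_real (root_exp l (p x)))
        = (\<integral>\<^sup>+x. phi (p x) (norm (g k x)) / ennreal l \<partial>lebesgue)"
      unfolding modular_def using that pos
      by (intro nn_integral_cong) (simp add: norm_divide phi_div_root_exp)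
    also have "\<dots> = modular p (g k) / ennreal l"
      unfolding modular_def by (intro nn_integral_divide measurable_phi meas) simp
    finally show ?thesis
      using that by (simp add: ennreal_divide_le_iff)
  qed
  have "Inf {ennreal l | l. 0 < l \<and> modular p (\<lambda>x. g k x / complex_of_real (root_exp l (p x))) \<le> 1}
      = modular p (g k)" for k
    using Inf_ennreal_positive_upper_bounds[of "modular p (g k)"]
    by (simp add: scale cong: conj_cong)
  then show ?thesis
    by (simp add: mixed_modular_def)
qed

lemma mixed_modular_level_seq:
  assumes [measurable]: "p \<in> borel_measurable lebesgue" "f \<in> borel_measurable lebesgue"
    and "\<And>x. 0 < p x"
  shows "mixed_modular p p (level_seq f) = (\<integral>\<^sup>+x. dyadic_sum (p x) (norm (f x)) \<partial>lebesgue)"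
proof -
  have "mixed_modular p p (level_seq f) = (\<Sum>\<^sub>\<infinity>k\<in>UNIV. modular p (level_seq f k))"
    using assms by (intro mixed_modular_diagonal measurable_level_seq)
  also have "\<dots> = (\<integral>\<^sup>+k. \<integral>\<^sup>+x. phi (p x) (layer (norm (f x)) k) \<partial>lebesgue \<partial>count_space UNIV)"
    by (simp add: infsum_ennreal_eq_nn_integral modular_def norm_level_seq)
  also have "\<dots> = (\<integral>\<^sup>+x. dyadic_sum (p x) (norm (f x)) \<partial>lebesgue)"
    unfolding dyadic_sum_def by (rule nn_integral_count_space_nn_integral[symmetric]) auto
  finally show ?thesis .
qed

section \<open>Comparison of the quasi-norms\<close>

text \<open>The essential infimum may be infinite; truncating at \<open>1\<close> yields a real lower bound.\<close>
lemma var_exponents_lower_bound: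
  assumes "p \<in> var_exponents"
  obtains a where "0 < a" "AE x in lebesgue. ennreal a \<le> p x"
proof -
  obtain c where c: "0 < c" "AE x in lebesgue. c \<le> p x"
    using assms by (auto simp: var_exponents_def essinf_def less_Sup_iff)
  define a where "a = enn2real (min c 1)"
  have "ennreal a = min c 1"
    unfolding a_def by (simp add: ennreal_enn2real_if min_def top_unique)
  moreover from this have "0 < a"
    using c by (metis ennreal_eq_0_iff min_less_iff_conj not_le less_irrefl zero_less_one)
  moreover have "AE x in lebesgue. min c 1 \<le> p x"
    using c(2) by eventually_elim (simp add: min.coboundedI1)
  ultimately show thesis
    using that[of a] by simp
qed

lemma modular_scale_down:
  assumes [measurable]: "p \<in> borel_measurable lebesgue" "f \<in> borel_measurable lebesgue"
    and a: "0 < a" "AE x in lebesgue. ennreal a \<le> p x" and c: "1 \<le> c"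
  shows "modular p (\<lambda>x. f x / complex_of_real c) \<le> ennreal (c powr - a) * modular p f"
proof -
  have "modular p (\<lambda>x. f x / complex_of_real c)
      \<le> (\<integral>\<^sup>+x. ennreal (c powr - a) * phi (p x) (norm (f x)) \<partial>lebesgue)"
    unfolding modular_def using a(2)
    by (intro nn_integral_mono_AE, elim eventually_mono)
      (use a c in \<open>simp add: norm_divide phi_scale_down\<close>)
  also have "\<dots> = ennreal (c powr - a) * modular p f"
    unfolding modular_def by (rule nn_integral_cmult) measurable
  finally show ?thesis .
qed

lemma modular_half_le_mixed_modular:
  assumes "p \<in> borel_measurable lebesgue" "f \<in> borel_measurable lebesgue" "\<And>x. 0 < p x"
  shows "modular p (\<lambda>x. f x / 2) \<le> mixed_modular p p (level_seq f)"
  unfolding mixed_modular_level_seq[OF assms] modular_def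
  by (intro nn_integral_mono) (simp add: norm_divide phi_half_le_dyadic_sum)

lemma mixed_modular_le_modular:
  assumes [measurable]: "p \<in> borel_measurable lebesgue" "f \<in> borel_measurable lebesgue"
    and pos: "\<And>x. 0 < p x" and a: "0 < a" "AE x in lebesgue. ennreal a \<le> p x"
  shows "mixed_modular p p (level_seq f) \<le> ennreal (1 / (1 - 2 powr - a)) * modular p f"
proof -
  have "mixed_modular p p (level_seq f)
      \<le> (\<integral>\<^sup>+x. ennreal (1 / (1 - 2 powr - a)) * phi (p x) (norm (f x)) \<partial>lebesgue)"
    unfolding mixed_modular_level_seq[OF assms(1,2) pos] using a(2)
    by (intro nn_integral_mono_AE, elim eventually_mono) (use a in \<open>simp add: dyadic_sum_le_phi\<close>)
  also have "\<dots> = ennreal (1 / (1 - 2 powr - a)) * modular p f"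
    unfolding modular_def by (rule nn_integral_cmult) measurable
  finally show ?thesis .
qed

text \<open>Both quasi-norms are infima of admissible scales. An inequality between them with constant \<open>c\<close>
  thus reduces to showing that multiplication by \<open>c\<close> carries scales admissible for one to scales
  admissible for the other.\<close>
lemma Inf_ennreal_le_mult_Inf:
  fixes P Q :: "real \<Rightarrow> bool"
  assumes c: "0 < c" and step: "\<And>l. 0 < l \<Longrightarrow> Q l \<Longrightarrow> P (c * l)"
  shows "Inf {ennreal l | l. 0 < l \<and> P l} \<le> ennreal c * Inf {ennreal l | l. 0 < l \<and> Q l}"
proof -
  have "Inf {ennreal l | l. 0 < l \<and> P l} / ennreal c \<le> Inf {ennreal l | l. 0 < l \<and> Q l}"
  proof (rule Inf_greatest)
    fix y assume "y \<in> {ennreal l | l. 0 < l \<and> Q l}"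
    then obtain l where l: "y = ennreal l" "0 < l" "Q l" by auto
    have "Inf {ennreal l | l. 0 < l \<and> P l} \<le> ennreal (c * l)"
      using l c step by (intro Inf_lower) auto
    also have "\<dots> = y * ennreal c"
      using l c by (simp add: ennreal_mult mult.commute)
    finally show "Inf {ennreal l | l. 0 < l \<and> P l} / ennreal c \<le> y"
      using c by (simp add: ennreal_divide_le_iff)
  qed
  then show ?thesis
    using c by (simp add: ennreal_divide_le_iff mult.commute)
qed

lemma var_Lebesgue_norm_le_var_Lorentz_norm:
  assumes p: "p \<in> borel_measurable lebesgue" "\<And>x. 0 < p x" and f: "f \<in> borel_measurable lebesgue"
  shows "var_Lebesgue_norm p f \<le> ennreal 2 * var_Lorentz_norm p p f"
  unfolding var_Lebesgue_norm_def var_Lorentz_norm_def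
proof (rule Inf_ennreal_le_mult_Inf)
  fix l :: real
  assume l: "0 < l" "mixed_modular p p (level_seq (\<lambda>x. f x / complex_of_real l)) \<le> 1"
  have "(\<lambda>x. f x / complex_of_real l) \<in> borel_measurable lebesgue"
    using f by measurable
  then have "modular p (\<lambda>x. f x / complex_of_real l / 2) \<le> 1"
    using p l(2) modular_half_le_mixed_modular order_trans by blast
  then show "modular p (\<lambda>x. f x / complex_of_real (2 * l)) \<le> 1"
    by (simp add: mult.commute)
qed simp

lemma var_Lorentz_norm_le_var_Lebesgue_norm:
  assumes "p \<in> var_exponents"
  shows "\<exists>C>0. \<forall>f\<in>borel_measurable lebesgue.
    var_Lorentz_norm p p f \<le> ennreal C * var_Lebesgue_norm p f"
proof -
  have p: "p \<in> borel_measurable lebesgue" "\<And>x. 0 < p x"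
    using assms by (auto simp: var_exponents_def)
  obtain a where a: "0 < a" "AE x in lebesgue. ennreal a \<le> p x"
    using var_exponents_lower_bound[OF assms] .
  define K where "K = 1 / (1 - 2 powr - a)"
  \<comment> \<open>chosen so that the gain \<open>C\<^bsup>-a\<^esup>\<close> from dilating by \<open>C\<close> cancels the loss \<open>K\<close> of the dyadic sum\<close>
  define C where "C = K powr (1 / a)"
  have a1: "2 powr - a < (1::real)" "0 < 2 powr - a" using a by (auto simp: powr_less_one)
  then have K: "1 \<le> K"
    by (simp add: K_def)
  then have C: "1 \<le> C" "K * C powr - a = 1"
    using a by (auto simp: C_def ge_one_powr_ge_zero powr_powr powr_minus)
  show ?thesis
  proof (intro exI conjI ballI)
    show "0 < C" using C by simp
    fix f :: "real ^ 'a \<Rightarrow> complex"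
    assume [measurable]: "f \<in> borel_measurable lebesgue"
    show "var_Lorentz_norm p p f \<le> ennreal C * var_Lebesgue_norm p f"
      unfolding var_Lebesgue_norm_def var_Lorentz_norm_def
    proof (rule Inf_ennreal_le_mult_Inf)
      fix l :: real
      assume l: "0 < l" "modular p (\<lambda>x. f x / complex_of_real l) \<le> 1"
      define g where "g = (\<lambda>x. f x / complex_of_real l)"
      have g [measurable]: "g \<in> borel_measurable lebesgue"
        unfolding g_def by measurable
      have "mixed_modular p p (level_seq (\<lambda>x. g x / complex_of_real C))
          \<le> ennreal K * modular p (\<lambda>x. g x / complex_of_real C)"
        unfolding K_def using p a by (intro mixed_modular_le_modular) simp_all
      also have "\<dots> \<le> ennreal K * (ennreal (C powr - a) * modular p g)"
        using p a C g by (intro mult_left_mono modular_scale_down) auto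
      also have "\<dots> = modular p g"
        using K C by (simp add: mult.assoc[symmetric] flip: ennreal_mult)
      also have "\<dots> \<le> 1"
        using l by (simp add: g_def)
      finally show "mixed_modular p p (level_seq (\<lambda>x. f x / complex_of_real (C * l))) \<le> 1"
        by (simp add: g_def mult.commute)
    qed (use C in simp)
  qed
qed

text \<open>Membership asks for a finite modular at some scale, a finite quasi-norm for a modular of at most
  \<open>1\<close> at some scale. A large enough dilation leads from the first to the second, by
  \<open>modular_scale_down\<close>.\<close>
lemma var_Lebesgue_iff_norm_finite:
  assumes "p \<in> var_exponents"
  shows "f \<in> var_Lebesgue p \<longleftrightarrow> f \<in> borel_measurable lebesgue \<and> var_Lebesgue_norm p f < \<infinity>"
proof (intro iffI conjI; (elim conjE)?)
  assume f: "f \<in> var_Lebesgue p"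
  then show [measurable]: "f \<in> borel_measurable lebesgue"
    by (simp add: var_Lebesgue_def)
  have p: "p \<in> borel_measurable lebesgue"
    using assms by (auto simp: var_exponents_def)
  obtain a where a: "0 < a" "AE x in lebesgue. ennreal a \<le> p x"
    using var_exponents_lower_bound[OF assms] .
  obtain l where l: "0 < l" "modular p (\<lambda>x. f x / complex_of_real l) < \<infinity>"
    using f by (auto simp: var_Lebesgue_def)
  define g where "g = (\<lambda>x. f x / complex_of_real l)"
  have g [measurable]: "g \<in> borel_measurable lebesgue"
    unfolding g_def by measurable
  \<comment> \<open>The summand \<open>1\<close> ensures \<open>I \<ge> 1\<close>, so that the dilation factor below is at least \<open>1\<close>.\<close>
  define I where "I = enn2real (modular p g) + 1"
  have I: "1 \<le> I" "modular p g \<le> ennreal I"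
    using l(2) by (auto simp: I_def g_def)
  define c where "c = I powr (1 / a)"
  have c: "1 \<le> c" "c powr - a * I = 1"
    using a I by (auto simp: c_def ge_one_powr_ge_zero powr_powr powr_minus)
  have "modular p (\<lambda>x. g x / complex_of_real c) \<le> ennreal (c powr - a) * modular p g"
    using p g a c by (intro modular_scale_down) auto
  also have "\<dots> \<le> ennreal (c powr - a) * ennreal I"
    using I by (intro mult_left_mono) auto
  also have "\<dots> = 1"
    using I c by (simp flip: ennreal_mult)
  finally have "modular p (\<lambda>x. f x / complex_of_real (c * l)) \<le> 1"
    by (simp add: g_def mult.commute)
  then have "var_Lebesgue_norm p f \<le> ennreal (c * l)"
    unfolding var_Lebesgue_norm_def using c l by (intro Inf_lower) auto
  then show "var_Lebesgue_norm p f < \<infinity>"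
    by (rule le_less_trans) simp
next
  assume f: "f \<in> borel_measurable lebesgue" "var_Lebesgue_norm p f < \<infinity>"
  then obtain l where l: "0 < l" "modular p (\<lambda>x. f x / complex_of_real l) \<le> 1"
    by (auto simp: var_Lebesgue_norm_def Inf_less_iff)
  have "modular p (\<lambda>x. f x / complex_of_real l) < \<infinity>"
    by (rule le_less_trans[OF l(2)]) simp
  with f(1) l(1) show "f \<in> var_Lebesgue p" by (auto simp: var_Lebesgue_def)
qed

theorem theorem6:
  fixes p :: "real ^ 'n \<Rightarrow> ennreal"
  assumes "p \<in> var_exponents"
  shows "equal_quasi_normed (var_Lorentz p p) (var_Lorentz_norm p p)
           (var_Lebesgue p) (var_Lebesgue_norm p)"
proof -
  have p: "p \<in> borel_measurable lebesgue" "\<And>x. 0 < p x"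
    using assms by (auto simp: var_exponents_def)
  obtain C where C: "0 < C" "\<And>f. f \<in> borel_measurable lebesgue
      \<Longrightarrow> var_Lorentz_norm p p f \<le> ennreal C * var_Lebesgue_norm p f"
    using var_Lorentz_norm_le_var_Lebesgue_norm[OF assms] by blast
  have two: "var_Lebesgue_norm p f \<le> ennreal 2 * var_Lorentz_norm p p f"
    if "f \<in> borel_measurable lebesgue" for f
    using var_Lebesgue_norm_le_var_Lorentz_norm[OF p that] .
  have finite_iff: "var_Lorentz_norm p p f < \<infinity> \<longleftrightarrow> var_Lebesgue_norm p f < \<infinity>"
    if "f \<in> borel_measurable lebesgue" for f
    using le_less_trans[OF C(2)[OF that], of \<infinity>] le_less_trans[OF two[OF that], of \<infinity>]
    by (auto simp: ennreal_mult_less_top)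
  have "var_Lorentz p p = var_Lebesgue p"
    using finite_iff by (auto simp: var_Lorentz_def var_Lebesgue_iff_norm_finite[OF assms])
  moreover have "\<forall>f\<in>var_Lorentz p p. var_Lorentz_norm p p f \<le> ennreal C * var_Lebesgue_norm p f"
    using C(2) by (auto simp: var_Lorentz_def)
  moreover have "\<forall>f\<in>var_Lorentz p p. var_Lebesgue_norm p f \<le> ennreal 2 * var_Lorentz_norm p p f"
    using two by (auto simp: var_Lorentz_def)
  ultimately show ?thesis
    unfolding equal_quasi_normed_def using C(1) zero_less_numeral by blast
qed

end
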